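(* Let $\alpha,\beta\in\mathbb{N}$. Then $$\bigl(\alpha\,L(q^{\alpha})-\beta\,L(q^{\beta})\bigr)^{2}\in M_{4}(\Gamma_{0}(\alpha\beta)).$$
   Context: $\mathbb{N}$ is the set of positive integers. For $n\in\mathbb{N}$, $\sigma(n)=\sum_{0<d\mid n}d$. For $|q|<1$, $L(q)=E_2(q)=1-24\sum_{n=1}^{\infty}\sigma(n)q^{n}$, and as functions on the upper half-plane we put $q=e^{2\pi i z}$. $M_{k}(\Gamma_{0}(N))$ denotes the complex vector space of modular forms of weight $k$ for $\Gamma_0(N)$ (trivial character). *)

theory Defs
  imports "HOL-Complex_Analysis.Complex_Analysis"
begin

definition divisor_sum :: "nat \<Rightarrow> nat" where
  "divisor_sum n = (\<Sum>d | d dvd n. d)"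

(* Meaningful for norm q < 1.  The series runs over positive exponents, hence the shift by Suc. *)
definition eisenstein_L :: "complex \<Rightarrow> complex" where
  "eisenstein_L q = 1 - 24 * (\<Sum>n. of_nat (divisor_sum (Suc n)) * q ^ Suc n)"

definition upper_half_plane :: "complex set" where
  "upper_half_plane = {z. Im z > 0}"

definition SL2Z :: "(int^2^2) set" where
  "SL2Z = {A. det A = 1}"

definition Gamma0 :: "nat \<Rightarrow> (int^2^2) set" where
  "Gamma0 N = {A \<in> SL2Z. int N dvd A $ 2 $ 1}"

definition moebius_act :: "int^2^2 \<Rightarrow> complex \<Rightarrow> complex" where
  "moebius_act A z =
     (of_int (A $ 1 $ 1) * z + of_int (A $ 1 $ 2)) / (of_int (A $ 2 $ 1) * z + of_int (A $ 2 $ 2))"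

definition slash :: "int \<Rightarrow> int^2^2 \<Rightarrow> (complex \<Rightarrow> complex) \<Rightarrow> complex \<Rightarrow> complex" where
  "slash k A f z = (of_int (A $ 2 $ 1) * z + of_int (A $ 2 $ 2)) powi (- k) * f (moebius_act A z)"

(* f is a function of the local parameter exp (2 pi i z / h) at infinity, for some period h,
   and this function extends holomorphically to the origin; equivalently, f has a Fourier
   expansion in that parameter without negative exponents. *)
definition holomorphic_at_infinity :: "(complex \<Rightarrow> complex) \<Rightarrow> bool" where
  "holomorphic_at_infinity f \<longleftrightarrow>
     (\<exists>h::nat. h > 0 \<and> (\<exists>g. g holomorphic_on ball 0 1 \<and>
        (\<forall>z\<in>upper_half_plane. f z = g (exp (2 * of_real pi * \<i> * z / of_nat h)))))"

(* The space M_k(G), for G of finite index in SL2Z.  Its elements are functions on the upper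
   half-plane; they are represented by total functions whose values elsewhere are irrelevant.
   Letting A range over all of SL2Z imposes holomorphy at every cusp of G. *)
definition modular_forms :: "int \<Rightarrow> (int^2^2) set \<Rightarrow> (complex \<Rightarrow> complex) set" where
  "modular_forms k G = {f.
     f holomorphic_on upper_half_plane \<and>
     (\<forall>A\<in>G. \<forall>z\<in>upper_half_plane. slash k A f z = f z) \<and>
     (\<forall>A\<in>SL2Z. holomorphic_at_infinity (slash k A f))}"

end

theory Submission
  imports Defs
begin

text \<open>Write E2(z) = L(exp(2 pi i z)).  This function fails to be modular of weight two only by an explicit
anomaly: for every matrix (a b; c d) of determinant one,

  E2((az + b)/(cz + d)) = (cz + d)^2 E2(z) - (6 i/pi) c (cz + d)

(\<open>eisenstein_E2_quasimodular\<close>).  The anomaly of n E2(nz) is the same for every n: moving the scaling matrix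
(n 0; 0 1) across (a b; c d) turns it into an upper triangular integer matrix (p t; 0 s) with ps = n,
the weight factors become

  n E2(n (az + b)/(cz + d)) = (cz + d)^2 (p/s) E2((pz + t)/s) - (6 i/pi) c (cz + d),

and the last term does not involve n (\<open>scaled_eisenstein_E2_transformation\<close>).  Hence it cancels in
alpha E2(alpha z) - beta E2(beta z), whose weight two slash by any modular matrix is a difference of
two functions (p/s) E2((pz + t)/s); squaring doubles the weight.  Such a function is a power series in
exp(2 pi i z/s), which gives holomorphy at all cusps at once.  If alpha and beta both divide c, both
triangular matrices are (n t; 0 1) with n the respective scaling factor, and the periodicity of E2
gives back the original function.

The transformation law of E2 for general matrices follows from the translation z + 1 and the inversion
-1/z by the Euclidean algorithm on the bottom row.  The inversion law is where analysis enters.  The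
Lambert series of the divisor sum and the partial fractions of 1/sin^2 identify (pi^2/3) E2(z) with the
iterated sum of 1/(mz + n)^2, taken over n first (\<open>eisenstein_G2_eq_E2\<close>); replacing z by -1/z exchanges
the order of summation.  The double series does not converge absolutely, but it does so after
subtracting 1/((mz + n - 1/2)(mz + n + 1/2)) from each term (\<open>corrected_term_summable\<close>).  The subtracted
terms telescope in n.  Summed over n first they contribute 0; summed over m first they produce
differences of cotangents, which telescope to the limit -2 pi i/z.  This is the anomaly
(\<open>eisenstein_G2_inversion\<close>).\<close>

section \<open>Sums over the integers and over products\<close>

lemma sum_symmetric_int_interval:
  fixes f :: "int \<Rightarrow> 'a::comm_monoid_add"
  shows "(\<Sum>k = - int N..int N. f k) = (\<Sum>n<Suc N. f (int n)) + (\<Sum>n<N. f (- int n - 1))"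
proof (induction N)
  case (Suc N)
  have "{- int (Suc N)..int (Suc N)} = insert (int (Suc N)) (insert (- int N - 1) {- int N..int N})"
    by auto
  then show ?case using Suc by (simp add: ac_simps)
qed simp

text \<open>The intervals from -N to N eventually contain every finite set of integers.  This lets the value of an
absolutely convergent sum be computed from telescoping symmetric partial sums.\<close>

lemma has_sum_int_symmetric_limit:
  fixes f :: "int \<Rightarrow> 'a::{comm_monoid_add,topological_space}"
  assumes "(f has_sum s) UNIV"
  shows "(\<lambda>N. \<Sum>k = - int N..int N. f k) \<longlonglongrightarrow> s"
proof -
  have "filterlim (\<lambda>N. {- int N..int N}) (finite_subsets_at_top UNIV) sequentially"
    unfolding filterlim_finite_subsets_at_top
  proof (intro allI impI)
    fix X :: "int set" assume X: "finite X \<and> X \<subseteq> UNIV"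
    define M where "M = nat (\<Sum>x\<in>X. \<bar>x\<bar>)"
    have M: "\<bar>x\<bar> \<le> int M" if "x \<in> X" for x
      unfolding M_def using member_le_sum[of x X abs] X that by auto
    show "\<forall>\<^sub>F N in sequentially. finite {- int N..int N} \<and> X \<subseteq> {- int N..int N} \<and> {- int N..int N} \<subseteq> UNIV"
      using eventually_ge_at_top[of M] by eventually_elim (use M in fastforce)
  qed
  with assms show ?thesis
    unfolding has_sum_def by (rule filterlim_compose)
qed

lemma has_sum_int_split:
  fixes f :: "int \<Rightarrow> 'a::topological_comm_monoid_add"
  assumes "((\<lambda>n. f (int n)) has_sum a) UNIV" "((\<lambda>n. f (- int n - 1)) has_sum b) UNIV"
  shows "(f has_sum (a + b)) UNIV"
proof -
  have "(f has_sum a) {0..}"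
    using assms(1) by (subst (asm) has_sum_reindex_bij_witness[of UNIV nat int "{0..}" f _ a a]) auto
  moreover have "(f has_sum b) {..<0}"
    using assms(2)
    by (subst (asm) has_sum_reindex_bij_witness[of UNIV "\<lambda>k. nat (- k - 1)" "\<lambda>n. - int n - 1" "{..<0}" f _ b b]) auto
  ultimately have "(f has_sum (a + b)) ({0..} \<union> {..<0})"
    by (rule has_sum_Un_disjoint) auto
  moreover have "{0..} \<union> {..<0} = (UNIV :: int set)" by auto
  ultimately show ?thesis by simp
qed

lemma has_sum_int_uminus:
  "((\<lambda>n::int. f (- n)) has_sum s) UNIV \<longleftrightarrow> (f has_sum s) UNIV"
  by (rule has_sum_reindex_bij_witness[of _ uminus uminus]) auto

lemma has_sum_nat_Suc:
  fixes f :: "nat \<Rightarrow> 'a::topological_comm_monoid_add"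
  assumes "((\<lambda>n. f (Suc n)) has_sum s) UNIV"
  shows "(f has_sum (f 0 + s)) UNIV"
proof -
  have "(f has_sum s) (range Suc)"
    using assms by (subst has_sum_reindex) (auto simp: o_def)
  moreover have "(f has_sum f 0) {0}"
    by (rule has_sum_finiteI) auto
  ultimately have "(f has_sum (f 0 + s)) ({0} \<union> range Suc)"
    by (intro has_sum_Un_disjoint) auto
  moreover have "{0} \<union> range Suc = (UNIV :: nat set)"
    using not0_implies_Suc by auto
  ultimately show ?thesis by simp
qed

lemma sum_telescope_symmetric:
  fixes f :: "real \<Rightarrow> 'a::ab_group_add"
  shows "(\<Sum>n = - int N..int N. f (of_int n - 1/2) - f (of_int n + 1/2)) = f (- of_nat N - 1/2) - f (of_nat N + 1/2)"
proof (induction N)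
  case (Suc N)
  have set: "{- int (Suc N)..int (Suc N)} = insert (int (Suc N)) (insert (- int N - 1) {- int N..int N})"
    by auto
  have arg: "of_int (- int N - 1) + 1/2 = - real N - 1/2" "of_int (int (Suc N)) - 1/2 = real N + 1/2"
    "of_int (- int N - 1) - 1/2 = - real (Suc N) - 1/2" "of_int (int (Suc N)) + 1/2 = real (Suc N) + 1/2"
    by auto
  have "(\<Sum>n\<in>insert (int (Suc N)) (insert (- int N - 1) {- int N..int N}).
        f (of_int n - 1/2) - f (of_int n + 1/2)) =
     (f (of_int (int (Suc N)) - 1/2) - f (of_int (int (Suc N)) + 1/2)) +
     ((f (of_int (- int N - 1) - 1/2) - f (of_int (- int N - 1) + 1/2)) +
      (f (- of_nat N - 1/2) - f (of_nat N + 1/2)))"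
    by (subst sum.insert; simp add: Suc.IH del: of_int_diff of_int_minus of_int_of_nat_eq of_nat_Suc)+
  then show ?case
    unfolding set arg by (simp del: of_nat_Suc)
qed simp

lemma has_sum_minus:
  fixes f g :: "'a \<Rightarrow> 'b::real_normed_vector"
  assumes "(f has_sum a) A" "(g has_sum b) A"
  shows "((\<lambda>x. f x - g x) has_sum (a - b)) A"
  using has_sum_add[OF assms(1) has_sum_scaleR[OF assms(2), of "- 1"]] by simp

lemma summable_on_product_swap:
  "(\<lambda>(x, y). f x y) summable_on A \<times> B \<longleftrightarrow> (\<lambda>(y, x). f x y) summable_on B \<times> A"
  by (rule summable_on_reindex_bij_witness[where i = prod.swap and j = prod.swap]) auto

lemma summable_on_product_row:
  fixes f :: "'a \<Rightarrow> 'b \<Rightarrow> 'c::banach"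
  assumes "(\<lambda>(x, y). f x y) summable_on A \<times> B" "x \<in> A"
  shows "f x summable_on B"
proof -
  have "(\<lambda>(x, y). f x y) summable_on Pair x ` B"
    by (rule summable_on_subset_banach[OF assms(1)]) (use assms(2) in auto)
  then show ?thesis
    by (subst (asm) summable_on_reindex) (auto simp: o_def inj_on_def)
qed

lemma has_sum_rows_columns:
  fixes f :: "'a \<Rightarrow> 'b \<Rightarrow> 'c::banach"
  assumes sum: "(\<lambda>(x, y). f x y) summable_on A \<times> B"
    and rows: "\<And>x. x \<in> A \<Longrightarrow> (f x has_sum r x) B"
    and cols: "\<And>y. y \<in> B \<Longrightarrow> ((\<lambda>x. f x y) has_sum c y) A"
  shows "\<exists>S. (r has_sum S) A \<and> (c has_sum S) B"
proof -
  from sum obtain S where S: "((\<lambda>(x, y). f x y) has_sum S) (A \<times> B)"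
    by (auto simp: summable_on_def)
  have "(r has_sum S) A"
    by (rule has_sum_Sigma[OF isUCont_plus S]) (use rows in auto)
  moreover have S': "((\<lambda>(y, x). f x y) has_sum S) (B \<times> A)"
    using S by (subst has_sum_reindex_bij_witness[where i = prod.swap and j = prod.swap and T = "A \<times> B"
          and h = "\<lambda>(x, y). f x y" and s' = S]) auto
  have "(c has_sum S) B"
    by (rule has_sum_Sigma[OF isUCont_plus S']) (use cols in auto)
  ultimately show ?thesis by blast
qed

section \<open>Partial fractions of the cotangent and of the inverse squared sine\<close>

lemma not_Ints_imp_not_nonpos_Ints:
  fixes z :: "'a::ring_char_0"
  assumes "z \<notin> \<int>"
  shows "z \<notin> \<int>\<^sub>\<le>\<^sub>0" "1 - z \<notin> \<int>\<^sub>\<le>\<^sub>0"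
proof -
  have "1 - z \<notin> \<int>"
    using assms Ints_diff[of 1 "1 - z"] by auto
  with assms show "z \<notin> \<int>\<^sub>\<le>\<^sub>0" "1 - z \<notin> \<int>\<^sub>\<le>\<^sub>0"
    using nonpos_Ints_subset_Ints by blast+
qed

text \<open>The logarithmic derivative of the reflection formula for the Gamma function.\<close>

lemma Digamma_reflection:
  fixes z :: complex
  assumes z: "z \<notin> \<int>"
  shows "Digamma (1 - z) - Digamma z = of_real pi * cot (of_real pi * z)"
proof -
  note z1 = not_Ints_imp_not_nonpos_Ints[OF z]
  have sin: "sin (of_real pi * z) \<noteq> 0"
    using z by (auto simp: sin_eq_0)
  have "((\<lambda>z. Gamma z * Gamma (1 - z)) has_field_derivative
     Gamma z * Gamma (1 - z) * (Digamma z - Digamma (1 - z))) (at z)"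
    using z1 by (auto intro!: derivative_eq_intros simp: algebra_simps)
  moreover have "((\<lambda>z. of_real pi / sin (of_real pi * z)) has_field_derivative
     - (of_real pi / sin (of_real pi * z)) * (of_real pi * cot (of_real pi * z))) (at z)"
    using sin by (auto intro!: derivative_eq_intros simp: cot_def field_simps power2_eq_square)
  ultimately have "(of_real pi / sin (of_real pi * z)) * (Digamma z - Digamma (1 - z)) =
     - (of_real pi / sin (of_real pi * z)) * (of_real pi * cot (of_real pi * z))"
    unfolding Gamma_reflection_complex by (rule DERIV_unique)
  then have "(of_real pi / sin (of_real pi * z)) *
      (Digamma (1 - z) - Digamma z - of_real pi * cot (of_real pi * z)) = 0"
    by algebra
  then show ?thesis using sin by simp
qed

lemma inverse_add_of_nat_tendsto_0: "(\<lambda>N. 1 / (z + of_nat N)) \<longlonglongrightarrow> (0::complex)"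
  by (intro tendsto_divide_0[OF tendsto_const] tendsto_add_filterlim_at_infinity[OF tendsto_const] tendsto_of_nat)

text \<open>The reflection formula turns the cotangent into a difference of two Digamma values.  In their limit
representations the logarithms cancel, and the two remaining sums are the halves of the symmetric sum
with nonnegative and with negative index.\<close>

lemma cot_partial_fractions:
  fixes z :: complex
  assumes z: "z \<notin> \<int>"
  shows "(\<lambda>N. \<Sum>k = - int N..int N. 1 / (z + of_int k)) \<longlonglongrightarrow> of_real pi * cot (of_real pi * z)"
proof -
  have z0: "z \<noteq> 0" "1 - z \<noteq> 0" using z by auto
  \<comment> \<open>The nonnegative half of the symmetric sum has one term more than the negative half.\<close>
  have "(\<lambda>N. (of_real (ln (real N)) - (\<Sum>n<N. inverse (1 - z + of_nat n)))
     - (of_real (ln (real N)) - (\<Sum>n<N. inverse (z + of_nat n))) + 1 / (z + of_nat N))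
      \<longlonglongrightarrow> Digamma (1 - z) - Digamma z + 0"
    by (intro tendsto_intros Digamma_LIMSEQ z0 inverse_add_of_nat_tendsto_0)
  moreover have "(\<Sum>k = - int N..int N. 1 / (z + of_int k)) =
     (of_real (ln (real N)) - (\<Sum>n<N. inverse (1 - z + of_nat n)))
     - (of_real (ln (real N)) - (\<Sum>n<N. inverse (z + of_nat n))) + 1 / (z + of_nat N)" for N
  proof -
    have "1 / (z + of_int (- int n - 1)) = - inverse (1 - z + of_nat n)" for n
    proof -
      have "z + of_int (- int n - 1) = - (1 - z + of_nat n)" by simp
      then show ?thesis by (simp only: inverse_eq_divide minus_divide_right)
    qed
    then show ?thesis
      by (simp add: sum_symmetric_int_interval sum_negf inverse_eq_divide)
  qed
  ultimately show ?thesis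
    using Digamma_reflection[OF z] by simp
qed

lemma Ints_complement_open: "open (- \<int> :: complex set)"
  using closed_Ints by (simp add: open_Compl)

text \<open>Differentiating the reflection formula replaces Digamma by the Trigamma function, whose defining
series over the naturals supplies the two halves of the sum over the integers.\<close>

lemma inverse_sin_squared_partial_fractions:
  fixes z :: complex
  assumes z: "z \<notin> \<int>"
  shows "((\<lambda>n::int. 1 / (z + of_int n) ^ 2) has_sum (of_real pi / sin (of_real pi * z)) ^ 2) UNIV"
proof -
  have z0: "z \<noteq> 0" "1 - z \<noteq> 0" using z by auto
  note z1 = not_Ints_imp_not_nonpos_Ints[OF z]
  have sin: "sin (of_real pi * z) \<noteq> 0"
    using z by (auto simp: sin_eq_0)
  have "((\<lambda>z. Digamma (1 - z) - Digamma z) has_field_derivative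
     - (Polygamma 1 (1 - z) + Polygamma 1 z)) (at z)"
    using z1 by (auto intro!: derivative_eq_intros DERIV_chain2[OF has_field_derivative_Polygamma])
  then have "((\<lambda>z. of_real pi * cot (of_real pi * z)) has_field_derivative
     - (Polygamma 1 (1 - z) + Polygamma 1 z)) (at z)"
    by (rule has_field_derivative_transform_within_open[OF _ Ints_complement_open])
       (use z Digamma_reflection in auto)
  moreover have "((\<lambda>z. of_real pi * cot (of_real pi * z)) has_field_derivative
     - ((of_real pi / sin (of_real pi * z)) ^ 2)) (at z)"
    using DERIV_chain2[OF DERIV_cot[OF sin] DERIV_cmult_Id[of "of_real pi"], THEN DERIV_cmult[of _ _ _ _ "of_real pi"]]
    by (simp add: power_divide divide_inverse power_mult_distrib power2_eq_square mult_ac)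
  ultimately have "- (Polygamma 1 (1 - z) + Polygamma 1 z) = - ((of_real pi / sin (of_real pi * z)) ^ 2)"
    by (rule DERIV_unique)
  then have eq: "Polygamma 1 z + Polygamma 1 (1 - z) = (of_real pi / sin (of_real pi * z)) ^ 2"
    by (simp only: neg_equal_iff_equal add.commute)
  have trigamma: "((\<lambda>n. 1 / (w + of_nat n) ^ 2) has_sum Polygamma 1 w) UNIV" if "w \<noteq> 0" for w :: complex
  proof (rule norm_summable_imp_has_sum)
    show "(\<lambda>n. 1 / (w + of_nat n) ^ 2) sums Polygamma 1 w"
      using Polygamma_LIMSEQ[OF that, of 1] by (simp add: numeral_2_eq_2 inverse_eq_divide)
    show "summable (\<lambda>n. norm (1 / (w + of_nat n) ^ 2))"
    proof (rule summable_comparison_test_ev)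
      show "summable (\<lambda>n. 4 * inverse (real n ^ 2))"
        by (intro summable_mult inverse_power_summable) auto
      have "norm (1 / (w + of_nat n) ^ 2) \<le> 4 * inverse (real n ^ 2)"
        if n: "n \<ge> nat \<lceil>2 * norm w\<rceil>" "n > 0" for n
      proof -
        have "real n / 2 \<le> norm (w + of_nat n)"
          using n norm_triangle_ineq2[of "of_nat n" "- w"] by (simp add: add.commute)
        then have "(real n / 2) ^ 2 \<le> norm (w + of_nat n) ^ 2"
          by (intro power_mono) auto
        moreover have "(real n / 2) ^ 2 > 0" using n by simp
        moreover from calculation have "norm (w + of_nat n) ^ 2 > 0" by linarith
        ultimately have "1 / norm (w + of_nat n) ^ 2 \<le> 1 / (real n / 2) ^ 2"
          by (intro divide_left_mono mult_pos_pos) auto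
        then show ?thesis
          by (simp add: norm_divide norm_power field_simps)
      qed
      then show "\<forall>\<^sub>F n in sequentially. norm (norm (1 / (w + of_nat n) ^ 2)) \<le> 4 * inverse (real n ^ 2)"
        by (intro eventually_mono[OF eventually_conj[OF
              eventually_ge_at_top[of "nat \<lceil>2 * norm w\<rceil>"] eventually_gt_at_top[of 0]]]) simp
    qed
  qed
  have "((\<lambda>n::int. 1 / (z + of_int n) ^ 2) has_sum (Polygamma 1 z + Polygamma 1 (1 - z))) UNIV"
  proof (rule has_sum_int_split)
    show "((\<lambda>n. 1 / (z + of_int (int n)) ^ 2) has_sum Polygamma 1 z) UNIV"
      using trigamma[OF z0(1)] by simp
    have "(z + of_int (- int n - 1)) ^ 2 = (1 - z + of_nat n) ^ 2" for n
      by (simp add: power2_eq_square algebra_simps)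
    then show "((\<lambda>n. 1 / (z + of_int (- int n - 1)) ^ 2) has_sum Polygamma 1 (1 - z)) UNIV"
      using trigamma[OF z0(2)] by simp
  qed
  with eq show ?thesis by simp
qed

lemma has_sum_inverse_squares_int:
  "((\<lambda>n::int. 1 / (of_int n :: complex) ^ 2) has_sum (of_real pi ^ 2 / 3)) UNIV"
proof -
  have "((\<lambda>n. 1 / (real n + 1)\<^sup>2) has_sum pi\<^sup>2 / 6) UNIV"
    using sums_nonneg_imp_has_sum[OF inverse_squares_sums] by (simp add: add.commute)
  then have "((\<lambda>n. complex_of_real (1 / (real n + 1)\<^sup>2)) has_sum of_real (pi\<^sup>2 / 6)) UNIV"
    by (rule has_sum_of_real)
  then have *: "((\<lambda>n. 1 / (of_nat n + 1)\<^sup>2 :: complex) has_sum of_real pi ^ 2 / 6) UNIV"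
    by simp
  have "((\<lambda>n. 1 / (of_nat n)\<^sup>2 :: complex) has_sum of_real pi ^ 2 / 6) UNIV"
    using has_sum_nat_Suc[of "\<lambda>n. 1 / (of_nat n)\<^sup>2 :: complex"] * by (simp add: add.commute)
  moreover have "1 / (of_int (- int n - 1) :: complex)\<^sup>2 = 1 / (of_nat n + 1)\<^sup>2" for n
    by (simp add: power2_eq_square algebra_simps)
  ultimately show ?thesis
    using * has_sum_int_split[of "\<lambda>n. 1 / (of_int n :: complex) ^ 2" "of_real pi ^ 2 / 6" "of_real pi ^ 2 / 6"]
    by simp
qed

lemma cot_eq_exp:
  "cot w = \<i> * (1 + exp (- 2 * \<i> * w)) / (1 - exp (- 2 * \<i> * w))" for w :: complex
proof -
  define e where "e = exp (\<i> * w)"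
  have e: "e \<noteq> 0" "exp (- (\<i> * w)) = 1 / e" "exp (- 2 * \<i> * w) = 1 / e ^ 2"
  proof -
    show "e \<noteq> 0" by (simp add: e_def)
    show "exp (- (\<i> * w)) = 1 / e" by (simp add: e_def exp_minus inverse_eq_divide)
    have "exp (- 2 * \<i> * w) = 1 / exp (2 * (\<i> * w))"
      by (simp add: exp_minus inverse_eq_divide mult.assoc)
    then show "exp (- 2 * \<i> * w) = 1 / e ^ 2" by (simp add: e_def exp_double)
  qed
  show ?thesis
    unfolding cot_def sin_exp_eq cos_exp_eq e(2,3) e_def[symmetric]
    using e(1) by (simp add: divide_simps) (simp add: power2_eq_square algebra_simps)
qed

text \<open>The imaginary parts of the arguments tend to minus infinity because 1/z lies in the lower half-plane, and
the cotangent tends to i in that direction.\<close>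

lemma cot_half_integer_limit:
  assumes z: "Im z > 0"
  shows "(\<lambda>N. cot (of_real pi * (of_real (of_nat N + 1/2) / z))) \<longlonglongrightarrow> \<i>"
proof -
  define p where "p = exp (- 2 * \<i> * of_real pi / z)"
  have "Re (- 2 * \<i> * of_real pi / z) < 0"
    using z by (simp add: Re_divide divide_neg_pos sum_power2_gt_zero_iff)
  then have "norm p < 1" unfolding p_def by (simp only: norm_exp_eq_Re exp_less_one_iff)
  then have p: "(\<lambda>N. p ^ N * exp (- \<i> * of_real pi / z)) \<longlonglongrightarrow> 0"
    by (intro tendsto_mult_left_zero LIMSEQ_power_zero)
  have "exp (- 2 * \<i> * (of_real pi * (of_real (of_nat N + 1/2) / z))) = p ^ N * exp (- \<i> * of_real pi / z)" for N
  proof -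
    have "- 2 * \<i> * (of_real pi * (of_real (of_nat N + 1/2) / z)) =
       of_nat N * (- 2 * \<i> * of_real pi / z) + (- \<i> * of_real pi / z)"
      by (simp add: algebra_simps add_divide_distrib diff_divide_distrib)
    then show ?thesis unfolding p_def exp_of_nat_mult[symmetric] exp_add[symmetric] by (simp only:)
  qed
  then have eq: "cot (of_real pi * (of_real (of_nat N + 1/2) / z)) =
     \<i> * (1 + p ^ N * exp (- \<i> * of_real pi / z)) / (1 - p ^ N * exp (- \<i> * of_real pi / z))" for N
    by (simp only: cot_eq_exp)
  have "(\<lambda>N. \<i> * (1 + p ^ N * exp (- \<i> * of_real pi / z)) / (1 - p ^ N * exp (- \<i> * of_real pi / z)))
     \<longlonglongrightarrow> \<i> * (1 + 0) / (1 - 0)"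
    by (intro tendsto_intros p) auto
  then show ?thesis unfolding eq by simp
qed

section \<open>The inversion formula for the weight two Eisenstein series\<close>

lemma Im_inversion_pos: "Im z > 0 \<Longrightarrow> Im (- 1 / z) > 0"
  by (simp add: Im_divide divide_pos_pos sum_power2_gt_zero_iff)

lemma half_integer_nonzero: "of_int n + 1/2 \<noteq> (0::real)" "of_int n - 1/2 \<noteq> (0::real)"
proof -
  have "2 * n + 1 \<noteq> 0" "2 * n - 1 \<noteq> 0" by presburger+
  then have "of_int (2 * n + 1) \<noteq> (0::real)" "of_int (2 * n - 1) \<noteq> (0::real)"
    by (simp_all only: of_int_eq_0_iff not_False_eq_True)
  then show "of_int n + 1/2 \<noteq> (0::real)" "of_int n - 1/2 \<noteq> (0::real)" by auto
qed

lemma add_half_integer_nonzero: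
  assumes "Im z > 0"
  shows "of_int m * z + of_int n + 1/2 \<noteq> 0" "of_int m * z + of_int n - 1/2 \<noteq> 0"
  using assms half_integer_nonzero[of n] by (auto simp: complex_eq_iff)

lemma summable_inverse_one_plus_square: "(\<lambda>n::int. 1 / (1 + (of_int n :: real) ^ 2)) summable_on UNIV"
proof -
  have s: "summable (\<lambda>n. 1 / (1 + (real n) ^ 2))"
  proof (rule summable_comparison_test_ev)
    show "summable (\<lambda>n. inverse (real n ^ 2))"
      by (rule inverse_power_summable) auto
    show "\<forall>\<^sub>F n in sequentially. norm (1 / (1 + (real n) ^ 2)) \<le> inverse (real n ^ 2)"
      using eventually_gt_at_top[of 0] by eventually_elim
        (auto simp: inverse_eq_divide intro!: divide_left_mono mult_pos_pos add_pos_pos)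
  qed
  have "summable (\<lambda>n. 1 / (1 + (real (Suc n)) ^ 2))"
    using s by (subst summable_Suc_iff)
  moreover have "(of_int (- int n - 1) :: real) ^ 2 = (real (Suc n)) ^ 2" for n
    by (simp add: power2_eq_square algebra_simps)
  ultimately have "(\<lambda>n. 1 / (1 + (of_int (- int n - 1) :: real) ^ 2)) summable_on UNIV"
    by (intro summable_nonneg_imp_summable_on) auto
  moreover have "(\<lambda>n. 1 / (1 + (of_int (int n) :: real) ^ 2)) summable_on UNIV"
    using s by (intro summable_nonneg_imp_summable_on) auto
  ultimately show ?thesis
    unfolding summable_on_def using has_sum_int_split[of "\<lambda>n. 1 / (1 + (of_int n :: real) ^ 2)"] by blast
qed

text \<open>Since 1 and z are linearly independent over the reals, the norm of mz + x is equivalent to the maximum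
norm of (m, x).  The imaginary part controls m, and then the triangle inequality controls x.\<close>

lemma real_multiples_lower_bound:
  assumes "Im z > 0"
  shows "\<exists>K>0. \<forall>m x::real. max \<bar>m\<bar> \<bar>x\<bar> \<le> K * norm (of_real m * z + of_real x)"
proof (intro exI conjI allI)
  define K where "K = 1 + (1 + norm z) / Im z"
  show "K > 0" using assms by (simp add: K_def add_pos_nonneg)
  fix m x :: real
  define w where "w = of_real m * z + of_real x"
  have "\<bar>m\<bar> * Im z = \<bar>Im w\<bar>" using assms by (simp add: w_def abs_mult)
  also have "\<dots> \<le> norm w" by (rule abs_Im_le_cmod)
  finally have m: "\<bar>m\<bar> \<le> norm w / Im z" using assms by (simp add: field_simps)
  have "\<bar>x\<bar> = norm (w - of_real m * z)" by (simp add: w_def)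
  also have "\<dots> \<le> norm w + \<bar>m\<bar> * norm z"
    by (metis norm_mult norm_of_real norm_triangle_ineq4)
  also have "\<dots> \<le> norm w + norm w / Im z * norm z"
    using m by (intro add_left_mono mult_right_mono) auto
  finally have x: "\<bar>x\<bar> \<le> norm w + norm w / Im z * norm z" .
  have K: "K * norm w = norm w + norm w / Im z + norm w / Im z * norm z"
    using assms by (simp add: K_def field_simps)
  have "norm w / Im z \<ge> 0" "norm w / Im z * norm z \<ge> 0" using assms by auto
  then show "max \<bar>m\<bar> \<bar>x\<bar> \<le> K * norm (of_real m * z + of_real x)"
    using m x norm_ge_zero[of w] unfolding w_def[symmetric] K by (simp only: max.bounded_iff) linarith
qed

text \<open>The subtracted product is centred at w so that it equals the difference 1/(w - 1/2) - 1/(w + 1/2), which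
telescopes along w, w + 1, w + 2, ...  At w = 0 the default value 1/0 = 0 omits the pole from the
Eisenstein series, and only the correction 4 remains.\<close>

definition corrected_term :: "complex \<Rightarrow> complex" where
  "corrected_term w = 1 / w ^ 2 - 1 / ((w - 1/2) * (w + 1/2))"

text \<open>The corrected term equals -1/(4 w^2 (w - 1/2)(w + 1/2)), hence decays like the fourth power of the maximum
norm M of (m, n).  As (1 + m^2)(1 + n^2) is at most 4 M^4, it is bounded by a product of two functions,
each summable over the integers.\<close>

lemma corrected_term_bound:
  assumes z: "Im z > 0"
  shows "\<exists>C. \<forall>m n::int. norm (corrected_term (of_int m * z + of_int n)) \<le>
           C * (1 / (1 + of_int m ^ 2) * (1 / (1 + of_int n ^ 2)))"
proof -
  from real_multiples_lower_bound[OF z] obtain K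
    where K: "K > 0" "\<And>m x::real. max \<bar>m\<bar> \<bar>x\<bar> \<le> K * norm (of_real m * z + of_real x)"
    by blast
  show ?thesis
  proof (intro exI allI)
    fix m n :: int
    define w where "w = of_int m * z + of_int n"
    define M where "M = max \<bar>real_of_int m\<bar> \<bar>real_of_int n\<bar>"
    define D where "D = (1 + (real_of_int m) ^ 2) * (1 + (real_of_int n) ^ 2)"
    have D1: "D \<ge> 1" 
      unfolding D_def by (rule mult_ge1_I) auto
    \<comment> \<open>The summand 4 in the constant takes care of m = n = 0, where the corrected term is 4.\<close>
    have "norm (corrected_term w) \<le> (4 * K ^ 4 + 4) / D"
    proof (cases "m = 0 \<and> n = 0")
      case True
      then show ?thesis by (simp add: w_def D_def corrected_term_def)
    next
      case False
      then have M1: "M \<ge> 1" by (auto simp: M_def max_def)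
      have w: "M \<le> K * norm w" using K(2)[of m n] by (simp add: M_def w_def)
      \<comment> \<open>Shifting an integer by a half cannot bring it closer to 0 than half its size.\<close>
      have half: "\<bar>real_of_int n\<bar> \<le> 2 * \<bar>real_of_int n - 1/2\<bar>" "\<bar>real_of_int n\<bar> \<le> 2 * \<bar>real_of_int n + 1/2\<bar>"
      proof -
        have "n \<le> -1 \<or> n = 0 \<or> n \<ge> 1" by arith
        then have "real_of_int n \<le> -1 \<or> real_of_int n = 0 \<or> real_of_int n \<ge> 1" by auto
        then show "\<bar>real_of_int n\<bar> \<le> 2 * \<bar>real_of_int n - 1/2\<bar>" "\<bar>real_of_int n\<bar> \<le> 2 * \<bar>real_of_int n + 1/2\<bar>"
          by (auto simp: abs_if)
      qed
      have w1: "M \<le> 2 * K * norm (w - 1/2)"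
        using K(2)[of m "n - 1/2"] half by (simp add: M_def w_def add_diff_eq) linarith
      have w2: "M \<le> 2 * K * norm (w + 1/2)"
        using K(2)[of m "n + 1/2"] half by (simp add: M_def w_def add.assoc) linarith
      have nz: "w \<noteq> 0" "w - 1/2 \<noteq> 0" "w + 1/2 \<noteq> 0"
        using w w1 w2 M1 by (metis mult_zero_right norm_zero not_one_le_zero order_trans)+
      have "M * M * (M * M) \<le> (K * norm w) * (K * norm w) * ((2 * K * norm (w - 1/2)) * (2 * K * norm (w + 1/2)))"
        using w w1 w2 M1 K(1) by (intro mult_mono) auto
      also have "\<dots> = 4 * K ^ 4 * norm (w ^ 2 * ((w - 1/2) * (w + 1/2)))"
        by (simp add: norm_mult norm_power power2_eq_square power4_eq_xxxx)
      finally have M4: "M * M * (M * M) \<le> 4 * K ^ 4 * norm (w ^ 2 * ((w - 1/2) * (w + 1/2)))" .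
      have sq: "1 + (real_of_int k) ^ 2 \<le> 2 * (M * M)" if "\<bar>real_of_int k\<bar> \<le> M" for k
      proof -
        have "(real_of_int k)^2 \<le> M * M" using that M1
          by (metis abs_le_square_iff abs_of_nonneg order_trans power2_eq_square zero_le_one)
        moreover have "1 \<le> M * M" using M1 by (rule mult_ge1_I[OF _ M1])
        ultimately show ?thesis by simp
      qed
      have "D \<le> (2 * (M * M)) * (2 * (M * M))"
        unfolding D_def by (intro mult_mono sq) (auto simp: M_def)
      with M4 have D: "D \<le> 16 * K ^ 4 * norm (w ^ 2 * ((w - 1/2) * (w + 1/2)))" by simp
      have "corrected_term w = - (1/4) / (w ^ 2 * ((w - 1/2) * (w + 1/2)))"
        using nz by (simp add: corrected_term_def divide_simps) (simp add: power2_eq_square algebra_simps)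
      then have "norm (corrected_term w) = 1/4 / norm (w ^ 2 * ((w - 1/2) * (w + 1/2)))"
        by (simp only: norm_divide norm_minus_cancel) simp
      also have "\<dots> \<le> 4 * K ^ 4 / D"
      proof -
        have "1/4 / P \<le> 4 * K ^ 4 / D" if "P > 0" "D \<le> 16 * K ^ 4 * P" for P
          using that D1 by (simp add: field_simps)
        then show ?thesis using D nz by simp
      qed
      also have "\<dots> \<le> (4 * K ^ 4 + 4) / D"
        using D1 by (intro divide_right_mono) auto
      finally show ?thesis .
    qed
    then show "norm (corrected_term (of_int m * z + of_int n)) \<le>
           (4 * K ^ 4 + 4) * (1 / (1 + of_int m ^ 2) * (1 / (1 + of_int n ^ 2)))"
      by (simp add: w_def D_def)
  qed
qed

lemma corrected_term_summable:
  assumes z: "Im z > 0"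
  shows "(\<lambda>(m::int, n::int). corrected_term (of_int m * z + of_int n)) summable_on UNIV \<times> UNIV"
proof -
  define g where "g n = 1 / (1 + (of_int n :: real) ^ 2)" for n :: int
  have g0: "g n \<ge> 0" for n by (simp add: g_def)
  have g: "g summable_on UNIV"
    using summable_inverse_one_plus_square by (simp add: g_def[abs_def])
  from corrected_term_bound[OF z] obtain C
    where C: "\<And>m n::int. norm (corrected_term (of_int m * z + of_int n)) \<le> C * (g m * g n)"
    unfolding g_def by blast
  have "(\<lambda>p. norm (case p of (m, n) \<Rightarrow> C * (g m * g n))) summable_on UNIV \<times> UNIV"
  proof (subst Infinite_Sum.abs_summable_on_Sigma_iff, intro conjI ballI)
    have norm: "norm (case (m, n) of (m, n) \<Rightarrow> C * (g m * g n)) = \<bar>C\<bar> * g m * g n" for m n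
      using g0 by (simp add: abs_mult)
    show "(\<lambda>n. norm (case (m, n) of (m, n) \<Rightarrow> C * (g m * g n))) summable_on UNIV" for m
      unfolding norm using g by (rule summable_on_cmult_right)
    have "(\<lambda>m. g m * (\<bar>C\<bar> * infsum g UNIV)) summable_on UNIV"
      using g by (rule summable_on_cmult_left)
    then show "(\<lambda>m. norm (\<Sum>\<^sub>\<infinity>n\<in>UNIV. norm (case (m, n) of (m, n) \<Rightarrow> C * (g m * g n)))) summable_on UNIV"
      unfolding norm infsum_cmult_right' using g0 infsum_nonneg[of UNIV g]
      by (simp add: abs_mult mult_ac)
  qed
  then have "(\<lambda>p. norm (case p of (m::int, n::int) \<Rightarrow> corrected_term (of_int m * z + of_int n))) summable_on UNIV \<times> UNIV"
    by (rule Infinite_Sum.abs_summable_on_comparison_test) (use C order_trans[OF _ abs_ge_self] in auto)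
  then show ?thesis by (rule abs_summable_summable)
qed

lemma of_int_mult_not_Ints: "Im z > 0 \<Longrightarrow> m \<noteq> 0 \<Longrightarrow> of_int m * z \<notin> \<int>"
  by (auto simp: complex_is_Int_iff)

text \<open>For m = 0 the term n = 0 is 1/0 = 0, so that this row is the sum of 1/n^2 over the nonzero integers.\<close>

definition eisenstein_row :: "complex \<Rightarrow> int \<Rightarrow> complex" where
  "eisenstein_row z m = (\<Sum>\<^sub>\<infinity>n::int. 1 / (of_int m * z + of_int n) ^ 2)"

lemma eisenstein_row_has_sum:
  assumes "Im z > 0"
  shows "((\<lambda>n::int. 1 / (of_int m * z + of_int n) ^ 2) has_sum eisenstein_row z m) UNIV"
proof (cases "m = 0")
  case True
  then show ?thesis unfolding eisenstein_row_def
    using has_sum_inverse_squares_int by (intro has_sum_infsum has_sum_imp_summable) auto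
next
  case False
  then show ?thesis unfolding eisenstein_row_def
    using inverse_sin_squared_partial_fractions[OF of_int_mult_not_Ints[OF assms False]]
    by (intro has_sum_infsum has_sum_imp_summable)
qed

text \<open>The identity mz + n = -z (n (-1/z) - m) turns columns for z into rows for -1/z.\<close>

lemma eisenstein_column_has_sum:
  assumes z: "Im z > 0"
  shows "((\<lambda>m::int. 1 / (of_int m * z + of_int n) ^ 2) has_sum (1 / z ^ 2 * eisenstein_row (- 1 / z) n)) UNIV"
proof -
  have z0: "z \<noteq> 0" using z by auto
  from eisenstein_row_has_sum[OF Im_inversion_pos[OF z], of n]
  have "((\<lambda>m::int. 1 / (of_int n * (- 1 / z) + of_int (- m)) ^ 2) has_sum eisenstein_row (- 1 / z) n) UNIV"
    by (subst has_sum_int_uminus)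
  then have "((\<lambda>m::int. 1 / z ^ 2 * (1 / (of_int n * (- 1 / z) + of_int (- m)) ^ 2)) has_sum
      (1 / z ^ 2 * eisenstein_row (- 1 / z) n)) UNIV"
    by (rule has_sum_cmult_right)
  moreover have "1 / z ^ 2 * (1 / (of_int n * (- 1 / z) + of_int (- m)) ^ 2) = 1 / (of_int m * z + of_int n) ^ 2" for m
  proof -
    have "z * (of_int n * (- 1 / z) + of_int (- m)) = - (of_int m * z + of_int n)"
      using z0 by (simp add: field_simps)
    then have "z ^ 2 * (of_int n * (- 1 / z) + of_int (- m)) ^ 2 = (of_int m * z + of_int n) ^ 2"
      by (metis power2_minus power_mult_distrib)
    then show ?thesis by simp
  qed
  ultimately show ?thesis by simp
qed

lemma correction_telescopes:
  assumes "Im z > 0" and w: "w = of_int m * z + of_int n"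
  shows "1 / w ^ 2 - corrected_term w = 1 / (w - 1/2) - 1 / (w + 1/2)"
  using add_half_integer_nonzero[OF assms(1), of m n] unfolding corrected_term_def w
  by (simp add: divide_simps)

text \<open>Along a row the corrections telescope to 0, because 1/(mz + x) vanishes as x tends to plus or minus infinity.\<close>

lemma corrected_row_has_sum:
  assumes z: "Im z > 0"
  shows "((\<lambda>n::int. corrected_term (of_int m * z + of_int n)) has_sum eisenstein_row z m) UNIV"
proof -
  let ?c = "\<lambda>n::int. corrected_term (of_int m * z + of_int n)"
  define f where "f x = 1 / (of_int m * z + of_real x)" for x
  have "?c summable_on UNIV"
    using summable_on_product_row[OF corrected_term_summable[OF z]] by simp
  then have c: "(?c has_sum infsum ?c UNIV) UNIV" by (rule has_sum_infsum)
  have "((\<lambda>n. 1 / (of_int m * z + of_int n) ^ 2 - ?c n) has_sum (eisenstein_row z m - infsum ?c UNIV)) UNIV"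
    by (rule has_sum_minus[OF eisenstein_row_has_sum[OF z] c])
  then have "(\<lambda>N. \<Sum>n = - int N..int N. 1 / (of_int m * z + of_int n) ^ 2 - ?c n)
      \<longlonglongrightarrow> eisenstein_row z m - infsum ?c UNIV"
    by (rule has_sum_int_symmetric_limit)
  moreover have "(\<Sum>n = - int N..int N. 1 / (of_int m * z + of_int n) ^ 2 - ?c n) =
     f (- of_nat N - 1/2) - f (of_nat N + 1/2)" for N
    unfolding sum_telescope_symmetric[symmetric]
    by (intro sum.cong) (simp_all add: correction_telescopes[OF z refl] f_def add_diff_eq add.assoc)
  moreover have "(\<lambda>N. f (- of_nat N - 1/2) - f (of_nat N + 1/2)) \<longlonglongrightarrow> 0"
  proof -
    have "(\<lambda>N. - (1 / ((1/2 - of_int m * z) + of_nat N)) - 1 / ((of_int m * z + 1/2) + of_nat N)) \<longlonglongrightarrow> - 0 - 0"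
      by (intro tendsto_intros inverse_add_of_nat_tendsto_0)
    moreover have "f (- of_nat N - 1/2) = - (1 / ((1/2 - of_int m * z) + of_nat N))" for N
      unfolding f_def minus_divide_right by simp
    moreover have "f (of_nat N + 1/2) = 1 / ((of_int m * z + 1/2) + of_nat N)" for N
      unfolding f_def by (simp add: add_ac)
    ultimately show ?thesis by simp
  qed
  ultimately have "eisenstein_row z m - infsum ?c UNIV = 0"
    by (simp only:) (rule LIMSEQ_unique)
  then show ?thesis using c by simp
qed

text \<open>Along a column the two parts 1/(mz + n - 1/2) and 1/(mz + n + 1/2) of the correction do not cancel; each of
them sums symmetrically to a value of the cotangent.\<close>

lemma corrected_column_has_sum:
  assumes z: "Im z > 0"
  defines "T \<equiv> \<lambda>x. of_real pi / z * cot (of_real pi * (of_real x / z))"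
  shows "((\<lambda>m::int. corrected_term (of_int m * z + of_int n)) has_sum
           (1 / z ^ 2 * eisenstein_row (- 1 / z) n - (T (of_int n - 1/2) - T (of_int n + 1/2)))) UNIV"
proof -
  let ?c = "\<lambda>m::int. corrected_term (of_int m * z + of_int n)"
  let ?s = "1 / z ^ 2 * eisenstein_row (- 1 / z) n"
  have z0: "z \<noteq> 0" using z by auto
  have "?c summable_on UNIV"
    using summable_on_product_row[OF summable_on_product_swap[THEN iffD1, OF corrected_term_summable[OF z]]] by simp
  then have c: "(?c has_sum infsum ?c UNIV) UNIV" by (rule has_sum_infsum)
  have "((\<lambda>m. 1 / (of_int m * z + of_int n) ^ 2 - ?c m) has_sum (?s - infsum ?c UNIV)) UNIV"
    by (rule has_sum_minus[OF eisenstein_column_has_sum[OF z] c])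
  then have "(\<lambda>N. \<Sum>m = - int N..int N. 1 / (of_int m * z + of_int n) ^ 2 - ?c m)
      \<longlonglongrightarrow> ?s - infsum ?c UNIV"
    by (rule has_sum_int_symmetric_limit)
  moreover have "(\<lambda>N. \<Sum>m = - int N..int N. 1 / (of_int m * z + of_int n) ^ 2 - ?c m)
      \<longlonglongrightarrow> T (of_int n - 1/2) - T (of_int n + 1/2)"
  proof -
    have cot: "(\<lambda>N. \<Sum>m = - int N..int N. 1 / (of_int m * z + of_real x)) \<longlonglongrightarrow> T x" if "x \<noteq> 0" for x
    proof -
      have "Im (of_real x / z) \<noteq> 0" using z that by (auto simp: Im_divide sum_power2_eq_zero_iff)
      then have "of_real x / z \<notin> \<int>" by (auto simp: complex_is_Int_iff)
      from tendsto_mult[OF tendsto_const cot_partial_fractions[OF this], of "1 / z"]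
      have "(\<lambda>N. 1 / z * (\<Sum>m = - int N..int N. 1 / (of_real x / z + of_int m))) \<longlonglongrightarrow> T x"
        by (simp add: T_def)
      moreover have "1 / z * (1 / (of_real x / z + of_int m)) = 1 / (of_int m * z + of_real x)" for m
        using z0 by (simp add: distrib_left add.commute mult.commute)
      ultimately show ?thesis by (simp only: sum_distrib_left)
    qed
    have "(\<Sum>m = - int N..int N. 1 / (of_int m * z + of_int n) ^ 2 - ?c m) =
       (\<Sum>m = - int N..int N. 1 / (of_int m * z + of_real (of_int n - 1/2))) -
       (\<Sum>m = - int N..int N. 1 / (of_int m * z + of_real (of_int n + 1/2)))" for N
      unfolding correction_telescopes[OF z refl] sum_subtractf by (simp add: add_diff_eq add.assoc)
    then show ?thesis
      using tendsto_diff[OF cot cot, OF half_integer_nonzero(2) half_integer_nonzero(1), of n n] by simp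
  qed
  ultimately have "?s - infsum ?c UNIV = T (of_int n - 1/2) - T (of_int n + 1/2)"
    by (rule LIMSEQ_unique)
  then have "infsum ?c UNIV = ?s - (T (of_int n - 1/2) - T (of_int n + 1/2))" by (simp add: algebra_simps)
  with c show ?thesis by (simp only:)
qed

text \<open>The weight two Eisenstein series in Eisenstein's order of summation: inside the rows first.\<close>

definition eisenstein_G2 :: "complex \<Rightarrow> complex" where
  "eisenstein_G2 z = (\<Sum>\<^sub>\<infinity>m. eisenstein_row z m)"

text \<open>The absolutely convergent corrected series can be summed by rows or by columns.  The rows give G2(z), the
columns give G2(-1/z)/z^2 minus a telescoping series of cotangent values, which sums to -2 pi i/z.\<close>

theorem eisenstein_G2_inversion:
  assumes z: "Im z > 0"
  shows "eisenstein_G2 (- 1 / z) = z ^ 2 * eisenstein_G2 z - 2 * of_real pi * \<i> * z"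
proof -
  have z0: "z \<noteq> 0" using z by auto
  note z' = Im_inversion_pos[OF z]
  have G2: "(eisenstein_row w has_sum eisenstein_G2 w) UNIV" if "Im w > 0" for w
  proof -
    have "eisenstein_row w summable_on UNIV"
      using has_sum_rows_columns[OF corrected_term_summable[OF that] corrected_row_has_sum[OF that]
          corrected_column_has_sum[OF that]]
      by (auto simp: summable_on_def)
    then show ?thesis unfolding eisenstein_G2_def by (rule has_sum_infsum)
  qed
  define T where "T x = of_real pi / z * cot (of_real pi * (of_real x / z))" for x
  let ?R = "\<lambda>n. 1 / z ^ 2 * eisenstein_row (- 1 / z) n"
  obtain S where S: "(eisenstein_row z has_sum S) UNIV"
     "((\<lambda>n. ?R n - (T (of_int n - 1/2) - T (of_int n + 1/2))) has_sum S) UNIV"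
    using has_sum_rows_columns[OF corrected_term_summable[OF z] corrected_row_has_sum[OF z]
        corrected_column_has_sum[OF z]] unfolding T_def by blast
  have "S = eisenstein_G2 z" using S(1) G2[OF z] by (rule has_sum_unique)
  moreover have "(?R has_sum (1 / z ^ 2 * eisenstein_G2 (- 1 / z))) UNIV"
    by (rule has_sum_cmult_right[OF G2[OF z']])
  ultimately have "((\<lambda>n. T (of_int n - 1/2) - T (of_int n + 1/2)) has_sum
     (1 / z ^ 2 * eisenstein_G2 (- 1 / z) - eisenstein_G2 z)) UNIV"
    using has_sum_minus[OF _ S(2), of ?R] by simp
  then have "(\<lambda>N. \<Sum>n = - int N..int N. T (of_int n - 1/2) - T (of_int n + 1/2))
      \<longlonglongrightarrow> 1 / z ^ 2 * eisenstein_G2 (- 1 / z) - eisenstein_G2 z"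
    by (rule has_sum_int_symmetric_limit)
  moreover have "(\<Sum>n = - int N..int N. T (of_int n - 1/2) - T (of_int n + 1/2)) =
     - 2 * (of_real pi / z) * cot (of_real pi * (of_real (of_nat N + 1/2) / z))" for N
  proof -
    have "T (- x) = - T x" for x
      unfolding T_def of_real_minus minus_divide_left[symmetric] mult_minus_right cot_minus ..
    from this[of "of_nat N + 1/2"] have "T (- of_nat N - 1/2) = - T (of_nat N + 1/2)" by simp
    then have "(\<Sum>n = - int N..int N. T (of_int n - 1/2) - T (of_int n + 1/2)) = - 2 * T (of_nat N + 1/2)"
      unfolding sum_telescope_symmetric by simp
    then show ?thesis by (simp only: T_def mult.assoc)
  qed
  moreover have "(\<lambda>N. - 2 * (of_real pi / z) * cot (of_real pi * (of_real (of_nat N + 1/2) / z)))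
     \<longlonglongrightarrow> - 2 * (of_real pi / z) * \<i>"
    by (intro tendsto_intros cot_half_integer_limit z)
  ultimately have "1 / z ^ 2 * eisenstein_G2 (- 1 / z) - eisenstein_G2 z = - 2 * (of_real pi / z) * \<i>"
    by (simp only:) (rule LIMSEQ_unique)
  then have "eisenstein_G2 (- 1 / z) = z ^ 2 * (eisenstein_G2 z + (- 2 * (of_real pi / z) * \<i>))"
    using z0 by (simp add: field_simps)
  also have "\<dots> = z ^ 2 * eisenstein_G2 z - 2 * of_real pi * \<i> * z"
    using z0 by (simp add: power2_eq_square algebra_simps)
  finally show ?thesis .
qed

section \<open>The Lambert series of the divisor sum\<close>

lemma geometric_deriv_has_sum:
  fixes x :: "'a::{real_normed_field,banach}"
  assumes "norm x < 1"
  shows "((\<lambda>k. of_nat (Suc k) * x ^ Suc k) has_sum (x / (1 - x) ^ 2)) UNIV"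
proof (rule norm_summable_imp_has_sum)
  show "(\<lambda>k. of_nat (Suc k) * x ^ Suc k) sums (x / (1 - x) ^ 2)"
    using sums_mult[OF geometric_deriv_sums[OF assms], of x] by (simp add: mult_ac)
  have "(\<lambda>k. norm x * (of_nat (Suc k) * norm x ^ k)) sums (norm x * (1 / (1 - norm x) ^ 2))"
    by (rule sums_mult[OF geometric_deriv_sums]) (use assms in auto)
  then have "summable (\<lambda>k. norm x * (of_nat (Suc k) * norm x ^ k))" by (rule sums_summable)
  moreover have "norm (of_nat (Suc k) * x ^ Suc k) = norm x * (of_nat (Suc k) * norm x ^ k)" for k
    by (simp only: norm_mult norm_power norm_of_nat power_Suc mult_ac)
  ultimately show "summable (\<lambda>k. norm (of_nat (Suc k) * x ^ Suc k))" by simp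
qed

text \<open>With r = norm q and m counted from 1, the norms in row m sum to r^m/(1 - r^m)^2, which is at most r^m/(1 - r)^2.\<close>

lemma lambert_series_summable:
  fixes q :: complex
  assumes q: "norm q < 1"
  shows "(\<lambda>(m, k). of_nat (Suc k) * (q ^ Suc m) ^ Suc k) summable_on UNIV \<times> UNIV"
proof (rule abs_summable_summable, subst Infinite_Sum.abs_summable_on_Sigma_iff, intro conjI ballI)
  define r where "r = norm q"
  have r: "0 \<le> r" "r < 1" using q by (auto simp: r_def)
  have pow: "r ^ Suc m < 1" "r ^ Suc m \<le> r" for m
    using r power_Suc_less_one[of r m] power_decreasing[of 1 "Suc m" r] by (cases "r = 0"; auto)+
  have norm: "norm (case (m, k) of (m, k) \<Rightarrow> of_nat (Suc k) * (q ^ Suc m) ^ Suc k) =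
      of_nat (Suc k) * (r ^ Suc m) ^ Suc k" for m k
    by (simp only: split norm_mult norm_power norm_of_nat r_def)
  have row: "((\<lambda>k. of_nat (Suc k) * (r ^ Suc m) ^ Suc k) has_sum (r ^ Suc m / (1 - r ^ Suc m) ^ 2)) UNIV" for m
    by (rule geometric_deriv_has_sum) (use r pow in auto)
  show "(\<lambda>k. norm (case (m, k) of (m, k) \<Rightarrow> of_nat (Suc k) * (q ^ Suc m) ^ Suc k)) summable_on UNIV" for m
    unfolding norm using row by (rule has_sum_imp_summable)
  have "summable (\<lambda>m. r ^ Suc m / (1 - r ^ Suc m) ^ 2)"
  proof (rule summable_comparison_test)
    show "summable (\<lambda>m. r ^ Suc m / (1 - r) ^ 2)"
      using r by (intro summable_divide) (simp add: summable_mult summable_geometric)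
    have "r ^ Suc m / (1 - r ^ Suc m) ^ 2 \<le> r ^ Suc m / (1 - r) ^ 2" for m
      using r pow[of m] by (intro divide_left_mono power_mono mult_pos_pos) auto
    then show "\<exists>N. \<forall>m\<ge>N. norm (r ^ Suc m / (1 - r ^ Suc m) ^ 2) \<le> r ^ Suc m / (1 - r) ^ 2"
      using r by (auto simp: abs_mult)
  qed
  then have "(\<lambda>m. r ^ Suc m / (1 - r ^ Suc m) ^ 2) summable_on UNIV"
    using r by (intro summable_nonneg_imp_summable_on) auto
  then show "(\<lambda>m. norm (\<Sum>\<^sub>\<infinity>k. norm (case (m, k) of (m, k) \<Rightarrow> of_nat (Suc k) * (q ^ Suc m) ^ Suc k))) summable_on UNIV"
    unfolding norm infsumI[OF row] using r by simp
qed

text \<open>The terms k q^(mk), for positive m and k, are grouped in two ways: by the product mk = n, with k running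
through the divisors of n, and by m, with a differentiated geometric series in each group.\<close>

lemma lambert_series_divisor_sum:
  fixes q :: complex
  assumes q: "norm q < 1"
  shows "\<exists>S. ((\<lambda>n. of_nat (divisor_sum (Suc n)) * q ^ Suc n) has_sum S) UNIV \<and>
             ((\<lambda>m. q ^ Suc m / (1 - q ^ Suc m) ^ 2) has_sum S) UNIV"
proof -
  from lambert_series_summable[OF q] obtain S
    where S: "((\<lambda>(m, k). of_nat (Suc k) * (q ^ Suc m) ^ Suc k) has_sum S) (UNIV \<times> UNIV)"
    by (auto simp: summable_on_def)
  have pow: "norm (q ^ Suc m) < 1" for m
    using q power_strict_mono[of "norm q" 1 "Suc m"] by (simp add: norm_power del: power_Suc)
  have "((\<lambda>m. q ^ Suc m / (1 - q ^ Suc m) ^ 2) has_sum S) UNIV"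
    by (rule has_sum_Sigma[OF isUCont_plus S]) (simp only: split geometric_deriv_has_sum[OF pow])
  moreover have S': "((\<lambda>(n, d). of_nat d * q ^ Suc n) has_sum S) (SIGMA n:UNIV. {d. d dvd Suc n})"
  proof (rule has_sum_reindex_bij_witness[THEN iffD2, OF _ _ _ _ _ refl S])
    \<comment> \<open>With indices starting at 0, the pair (m, k) stands for the divisor k + 1 of n + 1 = (m + 1)(k + 1).\<close>
    let ?i = "\<lambda>(m, k). (Suc m * Suc k - 1, Suc k)" and ?j = "\<lambda>(n, d). (Suc n div d - 1, d - 1)"
    {
      fix a assume "a \<in> (SIGMA n:UNIV. {d. d dvd Suc n})"
      then obtain n d where a: "a = (n, d)" and "d dvd Suc n" by auto
      then obtain e where e: "Suc n = d * e" by (auto simp: dvd_def)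
      then have "d > 0" "e > 0" by (auto intro: Nat.gr0I)
      then have eqs: "Suc n div d = e" "Suc (d - 1) = d" "Suc (e - 1) = e" "e * d = Suc n"
        using e by auto
      show "?i (?j a) = a"
        "(case ?j a of (m, k) \<Rightarrow> of_nat (Suc k) * (q ^ Suc m) ^ Suc k) = (case a of (n, d) \<Rightarrow> of_nat d * q ^ Suc n)"
        by (simp_all only: a prod.case eqs power_mult[symmetric] diff_Suc_1)
    }
  qed (auto simp del: mult_Suc mult_Suc_right)
  have "((\<lambda>n. of_nat (divisor_sum (Suc n)) * q ^ Suc n) has_sum S) UNIV"
  proof (rule has_sum_Sigma[OF isUCont_plus S'])
    fix n
    have "finite {d. d dvd Suc n}" by (rule finite_divisors_nat) simp
    then show "((\<lambda>d. case (n, d) of (n, d) \<Rightarrow> of_nat d * q ^ Suc n) has_sum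
        of_nat (divisor_sum (Suc n)) * q ^ Suc n) {d. d dvd Suc n}"
      by (intro has_sum_finiteI) (auto simp: divisor_sum_def sum_distrib_right)
  qed
  ultimately show ?thesis by blast
qed

lemma eisenstein_L_lambert:
  assumes "norm q < 1" "((\<lambda>m. q ^ Suc m / (1 - q ^ Suc m) ^ 2) has_sum S) UNIV"
  shows "eisenstein_L q = 1 - 24 * S"
proof -
  obtain S' where S': "((\<lambda>n. of_nat (divisor_sum (Suc n)) * q ^ Suc n) has_sum S') UNIV"
      "((\<lambda>m. q ^ Suc m / (1 - q ^ Suc m) ^ 2) has_sum S') UNIV"
    using lambert_series_divisor_sum[OF assms(1)] by blast
  have "S' = S" using S'(2) assms(2) by (rule has_sum_unique)
  with has_sum_imp_sums[OF S'(1)] show ?thesis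
    by (simp add: eisenstein_L_def sums_iff)
qed

lemma eisenstein_L_holomorphic: "eisenstein_L holomorphic_on ball 0 1"
proof -
  define a :: "nat \<Rightarrow> complex" where "a n = (if n = 0 then 0 else of_nat (divisor_sum n))" for n
  define f where "f q = (\<Sum>n. of_nat (divisor_sum (Suc n)) * q ^ Suc n)" for q :: complex
  have "f holomorphic_on ball 0 1"
  proof (rule power_series_holomorphic)
    fix q :: complex assume "q \<in> ball 0 1"
    then have "norm q < 1" by simp
    then obtain S where "((\<lambda>n. of_nat (divisor_sum (Suc n)) * q ^ Suc n) has_sum S) UNIV"
      using lambert_series_divisor_sum by blast
    then have "(\<lambda>n. of_nat (divisor_sum (Suc n)) * q ^ Suc n) sums f q"
      unfolding f_def by (intro summable_sums sums_summable[OF has_sum_imp_sums])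
    then have "(\<lambda>n. a (Suc n) * q ^ Suc n) sums f q" by (simp add: a_def)
    from sums_Suc[OF this] show "(\<lambda>n. a n * (q - 0) ^ n) sums f q" by (simp add: a_def)
  qed
  then have "(\<lambda>q. 1 - 24 * f q) holomorphic_on ball 0 1"
    by (intro holomorphic_intros)
  then show ?thesis by (simp add: f_def eisenstein_L_def[abs_def])
qed

definition eisenstein_E2 :: "complex \<Rightarrow> complex" where
  "eisenstein_E2 z = eisenstein_L (exp (2 * of_real pi * \<i> * z))"

lemma norm_exp_2pi_i_less_1: "Im z > 0 \<Longrightarrow> norm (exp (2 * of_real pi * \<i> * z)) < 1"
  by (simp add: norm_exp_eq_Re)

lemma inverse_sin_squared_eq_exp:
  "(of_real pi / sin (of_real pi * w)) ^ 2 = 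
     - 4 * of_real pi ^ 2 * (exp (2 * of_real pi * \<i> * w) / (1 - exp (2 * of_real pi * \<i> * w)) ^ 2)"
proof -
  define e where "e = exp (\<i> * (of_real pi * w))"
  have e0: "e \<noteq> 0" by (simp add: e_def)
  have e: "exp (- (\<i> * (of_real pi * w))) = 1 / e" "exp (2 * of_real pi * \<i> * w) = e ^ 2"
  proof -
    show "exp (- (\<i> * (of_real pi * w))) = 1 / e" by (simp add: e_def exp_minus inverse_eq_divide)
    have "2 * of_real pi * \<i> * w = 2 * (\<i> * (of_real pi * w))" by (simp add: mult_ac)
    then show "exp (2 * of_real pi * \<i> * w) = e ^ 2" by (simp only: e_def exp_double)
  qed
  have "sin (of_real pi * w) = - (1 - e ^ 2) / (2 * \<i> * e)"
    unfolding sin_exp_eq e e_def[symmetric] using e0 by (simp add: field_simps power2_eq_square)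
  then have "(of_real pi / sin (of_real pi * w)) ^ 2 = of_real pi ^ 2 * (2 * \<i> * e) ^ 2 / (1 - e ^ 2) ^ 2"
    using power2_commute[of 1 "e ^ 2"] by (simp add: power_divide power_mult_distrib)
  then show ?thesis unfolding e(2) by (simp add: power_mult_distrib)
qed

lemma eisenstein_row_eq:
  assumes "Im z > 0"
  shows "eisenstein_row z 0 = of_real pi ^ 2 / 3"
    and "m \<noteq> 0 \<Longrightarrow> eisenstein_row z m = (of_real pi / sin (of_real pi * (of_int m * z))) ^ 2"
  unfolding eisenstein_row_def
  using infsumI[OF has_sum_inverse_squares_int]
    infsumI[OF inverse_sin_squared_partial_fractions[OF of_int_mult_not_Ints[OF assms]]] by auto

text \<open>Row m and row -m of the double series are both equal to -4 pi^2 q^m/(1 - q^m)^2, and row 0 is pi^2/3; the sum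
of the rows is therefore the Lambert series up to normalisation.\<close>

lemma eisenstein_G2_eq_E2:
  assumes z: "Im z > 0"
  shows "eisenstein_G2 z = of_real pi ^ 2 / 3 * eisenstein_E2 z"
proof -
  define q where "q = exp (2 * of_real pi * \<i> * z)"
  have q: "norm q < 1" using norm_exp_2pi_i_less_1[OF z] by (simp add: q_def)
  obtain S where S: "((\<lambda>m. q ^ Suc m / (1 - q ^ Suc m) ^ 2) has_sum S) UNIV"
    using lambert_series_divisor_sum[OF q] by blast
  have pos: "eisenstein_row z (int (Suc m)) = - 4 * of_real pi ^ 2 * (q ^ Suc m / (1 - q ^ Suc m) ^ 2)" for m
  proof -
    have "exp (2 * of_real pi * \<i> * (of_int (int (Suc m)) * z)) = q ^ Suc m"
      unfolding q_def exp_of_nat_mult[symmetric] by (simp add: algebra_simps)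
    then show ?thesis
      by (subst eisenstein_row_eq(2)[OF z]) (simp_all only: inverse_sin_squared_eq_exp of_nat_eq_0_iff Suc_not_Zero not_False_eq_True)
  qed
  have neg: "eisenstein_row z (- int m - 1) = eisenstein_row z (int (Suc m))" for m
  proof -
    have "of_real pi * (of_int (- int m - 1) * z) = - (of_real pi * (of_int (int (Suc m)) * z))"
      by (simp add: algebra_simps)
    then have "sin (of_real pi * (of_int (- int m - 1) * z)) = - sin (of_real pi * (of_int (int (Suc m)) * z))"
      by (simp only: sin_minus)
    moreover have nz: "- int m - 1 \<noteq> 0" "int (Suc m) \<noteq> 0" by auto
    ultimately show ?thesis
      by (simp only: eisenstein_row_eq(2)[OF z nz(1)] eisenstein_row_eq(2)[OF z nz(2)] power_divide power2_minus)
  qed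
  have s: "((\<lambda>m. eisenstein_row z (int (Suc m))) has_sum (- 4 * of_real pi ^ 2 * S)) UNIV"
    unfolding pos using S by (rule has_sum_cmult_right)
  have "(eisenstein_row z has_sum ((eisenstein_row z (int 0) + - 4 * of_real pi ^ 2 * S) + - 4 * of_real pi ^ 2 * S)) UNIV"
  proof (rule has_sum_int_split)
    show "((\<lambda>m. eisenstein_row z (int m)) has_sum (eisenstein_row z (int 0) + - 4 * of_real pi ^ 2 * S)) UNIV"
      by (rule has_sum_nat_Suc[OF s])
    show "((\<lambda>m. eisenstein_row z (- int m - 1)) has_sum - 4 * of_real pi ^ 2 * S) UNIV"
      unfolding neg by (rule s)
  qed
  then have "eisenstein_G2 z = of_real pi ^ 2 / 3 - 8 * of_real pi ^ 2 * S"
    unfolding eisenstein_G2_def using eisenstein_row_eq(1)[OF z] by (simp add: infsumI)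
  moreover have "eisenstein_E2 z = 1 - 24 * S"
    using eisenstein_L_lambert[OF q S] by (simp only: eisenstein_E2_def q_def)
  ultimately show ?thesis by (simp only:) (simp add: algebra_simps)
qed

lemma eisenstein_E2_inversion:
  assumes z: "Im z > 0"
  shows "eisenstein_E2 (- 1 / z) = z ^ 2 * eisenstein_E2 z - 6 * \<i> / of_real pi * z"
proof -
  have "of_real pi ^ 2 / 3 * eisenstein_E2 (- 1 / z) =
      z ^ 2 * (of_real pi ^ 2 / 3 * eisenstein_E2 z) - 2 * of_real pi * \<i> * z"
    using eisenstein_G2_inversion[OF z] eisenstein_G2_eq_E2[OF z] eisenstein_G2_eq_E2[OF Im_inversion_pos[OF z]]
    by simp
  also have "\<dots> = of_real pi ^ 2 / 3 * (z ^ 2 * eisenstein_E2 z - 6 * \<i> / of_real pi * z)"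
    by (simp add: field_simps power2_eq_square)
  finally show ?thesis by simp
qed

section \<open>Quasimodularity under the full modular group\<close>

lemma eisenstein_E2_plus_int: "eisenstein_E2 (z + of_int k) = eisenstein_E2 z"
proof -
  have "exp (2 * of_real pi * \<i> * (z + of_int k)) = exp (2 * of_real pi * \<i> * z) * exp (2 * of_int k * of_real pi * \<i>)"
    by (simp add: exp_add[symmetric] algebra_simps)
  then show ?thesis
    using exp_integer_2pi[of "of_int k"] by (simp add: eisenstein_E2_def)
qed

lemma denominator_nonzero:
  assumes "Im z > 0" "a * d - b * c = (1::int)"
  shows "of_int c * z + of_int d \<noteq> (0::complex)"
proof
  assume "of_int c * z + of_int d = 0"
  then have "Im (of_int c * z + of_int d) = 0" "Re (of_int c * z + of_int d) = 0" by simp_all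
  then have "c = 0" "d = 0" using assms(1) by auto
  with assms(2) show False by simp
qed

text \<open>Induction on the size of the lower left entry c.  For c = 0 the matrix acts as a translation.  Otherwise
division with remainder d = ck + r writes the matrix as the product of (b - ak, -a; r, -c), which has the
smaller lower left entry r, with the map sending z to -1/(z + k).\<close>

theorem eisenstein_E2_quasimodular:
  fixes a b c d :: int
  assumes "a * d - b * c = 1" "Im z > 0"
  shows "eisenstein_E2 ((of_int a * z + of_int b) / (of_int c * z + of_int d)) =
    (of_int c * z + of_int d) ^ 2 * eisenstein_E2 z - 6 * \<i> / of_real pi * of_int c * (of_int c * z + of_int d)"
  using assms
proof (induction "nat \<bar>c\<bar>" arbitrary: a b c d z rule: less_induct)
  case less
  note det = less.prems(1) and z = less.prems(2)
  show ?case
  proof (cases "c = 0")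
    case True
    then have "a * d = 1" using det by simp
    then have "a = 1 \<and> d = 1 \<or> a = -1 \<and> d = -1" by (simp add: zmult_eq_1_iff)
    then show ?thesis
      using eisenstein_E2_plus_int[of z b] eisenstein_E2_plus_int[of z "- b"] True by auto
  next
    case False
    define k r where "k = d div c" and "r = d mod c"
    have d: "d = c * k + r" by (simp add: k_def r_def)
    have r: "\<bar>r\<bar> < \<bar>c\<bar>" using False by (simp add: r_def abs_mod_less)
    define u where "u = z + of_int k"
    have u: "Im u > 0" using z by (simp add: u_def)
    then have u0: "u \<noteq> 0" by auto
    have den: "of_int c * z + of_int d = of_int c * u + of_int r"
      by (simp add: u_def d algebra_simps)
    have num: "of_int a * z + of_int b = of_int a * u + of_int (b - a * k)"
      by (simp add: u_def algebra_simps)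
    have "(b - a * k) * (- c) - (- a) * r = 1"
      using det by (simp add: d algebra_simps)
    from less.hyps[OF _ this Im_inversion_pos[OF u]] r
    have IH: "eisenstein_E2 ((of_int (b - a * k) * (- 1 / u) + of_int (- a)) / (of_int r * (- 1 / u) + of_int (- c))) =
      (of_int r * (- 1 / u) + of_int (- c)) ^ 2 * eisenstein_E2 (- 1 / u)
        - 6 * \<i> / of_real pi * of_int r * (of_int r * (- 1 / u) + of_int (- c))"
      by simp
    have n: "of_int (b - a * k) * (- 1 / u) + of_int (- a) = - (of_int a * u + of_int (b - a * k)) / u"
      using u0 by (simp add: field_simps)
    have m: "of_int r * (- 1 / u) + of_int (- c) = - (of_int c * u + of_int r) / u"
      using u0 by (simp add: field_simps)
    define w where "w = of_int c * u + of_int r"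
    have frac: "(- X / u) / (- w / u) = X / w" for X
      using u0 by simp
    have "eisenstein_E2 ((of_int a * u + of_int (b - a * k)) / w) =
        (- w / u) ^ 2 * (u ^ 2 * eisenstein_E2 u - 6 * \<i> / of_real pi * u)
          - 6 * \<i> / of_real pi * of_int r * (- w / u)"
      using IH unfolding n m eisenstein_E2_inversion[OF u] w_def[symmetric] frac .
    also have "\<dots> = w ^ 2 * eisenstein_E2 u - 6 * \<i> / of_real pi * (w * ((w - of_int r) / u))"
      using u0 by (simp add: field_simps power2_eq_square)
    also have "(w - of_int r) / u = of_int c" using u0 by (simp add: w_def)
    also have "eisenstein_E2 u = eisenstein_E2 z" by (simp add: u_def eisenstein_E2_plus_int)
    finally show ?thesis unfolding den num w_def[symmetric] by (simp add: mult_ac)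
  qed
qed

text \<open>With p = gcd(n, c), the first column (na, c) of (na nb; c d) is p times a coprime column (sa, c/p), which is
completed to a matrix of determinant one.  This factors (na nb; c d) as that matrix times (p t; 0 s).  The
anomaly loses its dependence on n because n (c/p)/s = c.  The special case n dvd c, where p = n, is recorded
for use with the congruence subgroup.\<close>

lemma scaled_eisenstein_E2_transformation:
  fixes a b c d :: int and n :: nat
  assumes det: "a * d - b * c = 1" and n: "n > 0"
  obtains p s :: nat and t :: int where "p > 0" "s > 0" "int n dvd c \<Longrightarrow> p = n \<and> s = 1"
    "\<And>z. Im z > 0 \<Longrightarrow>
       of_nat n * eisenstein_E2 (of_nat n * ((of_int a * z + of_int b) / (of_int c * z + of_int d))) =
       (of_int c * z + of_int d) ^ 2 * (of_nat p / of_nat s * eisenstein_E2 ((of_nat p * z + of_int t) / of_nat s))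
         - 6 * \<i> / of_real pi * of_int c * (of_int c * z + of_int d)"
proof -
  define g where "g = gcd (int n) c"
  have g: "g > 0" using n by (simp add: g_def)
  then have "gcd (int n) c \<noteq> 0" by (simp add: g_def)
  from gcd_coprime_exists[OF this]
  obtain s' c1 where s': "int n = g * s'" and c1: "c = g * c1" and cop: "coprime s' c1"
    unfolding g_def by (metis mult.commute)
  have "g * s' > 0" using n by (simp add: s'[symmetric])
  then have s'0: "s' > 0" using g by (simp add: zero_less_mult_iff)
  note cop
  moreover have "coprime a c1"
  proof (rule coprimeI)
    fix x assume "x dvd a" "x dvd c1"
    then have "x dvd a * d - b * c" by (simp add: c1)
    then show "is_unit x" using det by simp
  qed
  ultimately have "coprime (s' * a) c1" by simp
  then obtain d1 b1' where "d1 * (s' * a) + b1' * c1 = 1"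
    using bezout_int[of "s' * a" c1] by (metis coprime_imp_gcd_eq_1)
  then have "(s' * a) * d1 - (- b1') * c1 = 1" by (simp add: mult.commute)
  then obtain b1 where B: "(s' * a) * d1 - b1 * c1 = 1" ..
  \<comment> \<open>The entry t results from multiplying (na nb; c d) on the left by the inverse of (sa b1; c/p d1).\<close>
  define t where "t = d1 * int n * b - b1 * d"
  define p s where "p = nat g" and "s = nat s'"
  have ps: "int p = g" "int s = s'" using g s'0 by (auto simp: p_def s_def)
  show ?thesis
  proof (rule that[of p s t])
    show "p > 0" "s > 0" using g s'0 by (auto simp: p_def s_def)
    show "p = n \<and> s = 1" if "int n dvd c"
    proof -
      have "g = int n" using that by (simp add: g_def gcd_proj1_if_dvd)
      then show ?thesis using s' n by (auto simp: p_def s_def)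
    qed
  next
    fix z assume z: "Im z > 0"
    define w where "w = (of_nat p * z + of_int t) / (of_nat s :: complex)"
    define j where "j = of_int c * z + of_int d"
    have s0: "(of_nat s :: complex) \<noteq> 0" using s'0 by (simp add: s_def)
    have "Im w > 0" using z g s'0 by (simp add: w_def Im_divide_of_nat p_def s_def)
    from eisenstein_E2_quasimodular[OF B this]
    have E: "eisenstein_E2 ((of_int (s' * a) * w + of_int b1) / (of_int c1 * w + of_int d1)) =
      (of_int c1 * w + of_int d1) ^ 2 * eisenstein_E2 w - 6 * \<i> / of_real pi * of_int c1 * (of_int c1 * w + of_int d1)" .
    have i: "c1 * g = c" "c1 * t + d1 * s' = d" "s' * a * g = int n * a" "s' * a * t + b1 * s' = int n * b"
    proof -
      show "c1 * g = c" "s' * a * g = int n * a" by (simp_all add: c1 s')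
      show "c1 * t + d1 * s' = d" "s' * a * t + b1 * s' = int n * b"
        using det B c1 s' unfolding t_def by algebra+
    qed
    have i': "of_int c1 * of_nat p = (of_int c :: complex)" "of_int c1 * of_int t + of_int d1 * of_nat s = (of_int d :: complex)"
      "of_int (s' * a) * of_nat p = (of_nat n * of_int a :: complex)"
      "of_int (s' * a) * of_int t + of_int b1 * of_nat s = (of_nat n * of_int b :: complex)"
      using i[THEN arg_cong[where f = "of_int :: int \<Rightarrow> complex"]] unfolding ps[symmetric]
      by (simp_all only: of_int_mult of_int_add of_int_of_nat_eq)
    have den: "of_int c1 * w + of_int d1 = j / of_nat s"
    proof -
      have "of_int c1 * w + of_int d1 =
          ((of_int c1 * of_nat p) * z + (of_int c1 * of_int t + of_int d1 * of_nat s)) / of_nat s"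
        using s0 by (simp add: w_def field_simps)
      then show ?thesis unfolding i' j_def .
    qed
    have num: "of_int (s' * a) * w + of_int b1 = of_nat n * (of_int a * z + of_int b) / of_nat s"
    proof -
      have "of_int (s' * a) * w + of_int b1 =
          ((of_int (s' * a) * of_nat p) * z + (of_int (s' * a) * of_int t + of_int b1 * of_nat s)) / of_nat s"
        using s0 by (simp add: w_def field_simps)
      then show ?thesis unfolding i' by (simp add: algebra_simps)
    qed
    have frac: "(X / of_nat s) / (j / of_nat s) = X / j" for X
      using s0 by simp
    have ns: "of_nat n = (of_nat p * of_nat s :: complex)"
      using s' ps by (metis of_nat_eq_iff of_nat_mult)
    have "of_nat n * eisenstein_E2 (of_nat n * ((of_int a * z + of_int b) / j)) =
       of_nat n * ((j / of_nat s) ^ 2 * eisenstein_E2 w - 6 * \<i> / of_real pi * of_int c1 * (j / of_nat s))"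
      using E unfolding den num frac by simp
    also have "\<dots> = j ^ 2 * (of_nat p / of_nat s * eisenstein_E2 w) - 6 * \<i> / of_real pi * (of_int c1 * of_nat p) * j"
      unfolding ns using s0 by (simp add: field_simps power2_eq_square)
    finally show "of_nat n * eisenstein_E2 (of_nat n * ((of_int a * z + of_int b) / (of_int c * z + of_int d))) =
       (of_int c * z + of_int d) ^ 2 * (of_nat p / of_nat s * eisenstein_E2 ((of_nat p * z + of_int t) / of_nat s))
         - 6 * \<i> / of_real pi * of_int c * (of_int c * z + of_int d)"
      unfolding i' j_def w_def .
  qed
qed

section \<open>The squared difference as a modular form of weight four\<close>

lemma eisenstein_E2_holomorphic: "eisenstein_E2 holomorphic_on {z. Im z > 0}"
proof -
  have "(eisenstein_L \<circ> (\<lambda>z. exp (2 * of_real pi * \<i> * z))) holomorphic_on {z. Im z > 0}"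
    by (rule holomorphic_on_compose_gen[OF _ eisenstein_L_holomorphic])
       (auto intro!: holomorphic_intros norm_exp_2pi_i_less_1)
  then show ?thesis by (simp add: o_def eisenstein_E2_def[abs_def])
qed

text \<open>The extra factor r in the denominator allows two functions with different denominators s to be expressed
in one common local parameter.\<close>

lemma eisenstein_E2_scaled_local_parameter:
  fixes p s r :: nat and t :: int
  assumes "p > 0" "s > 0" "r > 0"
  obtains \<phi> where "\<phi> holomorphic_on ball 0 1"
    "\<And>z. eisenstein_E2 ((of_nat p * z + of_int t) / of_nat s) =
       \<phi> (exp (2 * of_real pi * \<i> * z / of_nat (s * r)))"
proof
  define \<zeta> where "\<zeta> = exp (2 * of_real pi * \<i> * (of_int t / of_nat s))"
  have \<zeta>: "norm \<zeta> = 1" unfolding \<zeta>_def by (simp add: norm_exp_eq_Re)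
  let ?\<phi> = "\<lambda>u. eisenstein_L (\<zeta> * u ^ (p * r))"
  have "norm (\<zeta> * u ^ (p * r)) < 1" if "norm u < 1" for u
    using that assms power_strict_mono[of "norm u" 1 "p * r"] by (simp add: \<zeta> norm_mult norm_power)
  then have "(eisenstein_L \<circ> (\<lambda>u. \<zeta> * u ^ (p * r))) holomorphic_on ball 0 1"
    by (intro holomorphic_on_compose_gen[OF _ eisenstein_L_holomorphic])
       (auto intro!: holomorphic_intros)
  then show "?\<phi> holomorphic_on ball 0 1" by (simp add: o_def)
  fix z
  have "2 * of_real pi * \<i> * ((of_nat p * z + of_int t) / of_nat s) =
     2 * of_real pi * \<i> * (of_int t / of_nat s) + of_nat (p * r) * (2 * of_real pi * \<i> * z / of_nat (s * r))"
    using assms by (simp add: field_simps)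
  then have "exp (2 * of_real pi * \<i> * ((of_nat p * z + of_int t) / of_nat s)) =
     \<zeta> * exp (2 * of_real pi * \<i> * z / of_nat (s * r)) ^ (p * r)"
    by (simp only: exp_add exp_of_nat_mult \<zeta>_def)
  then show "eisenstein_E2 ((of_nat p * z + of_int t) / of_nat s) = ?\<phi> (exp (2 * of_real pi * \<i> * z / of_nat (s * r)))"
    by (simp only: eisenstein_E2_def)
qed

text \<open>The anomaly in the transformation of n E2(nz) is the same for both scaling factors, so the difference
transforms with weight exactly two and its square with weight four.\<close>

lemma slash_E2_difference:
  fixes \<alpha> \<beta> :: nat and A :: "int^2^2"
  assumes A: "A \<in> SL2Z" and pos: "\<alpha> > 0" "\<beta> > 0"
  defines "f \<equiv> \<lambda>z. (of_nat \<alpha> * eisenstein_E2 (of_nat \<alpha> * z) - of_nat \<beta> * eisenstein_E2 (of_nat \<beta> * z)) ^ 2"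
  obtains p s p' s' :: nat and t t' :: int where "p > 0" "s > 0" "p' > 0" "s' > 0"
    "int \<alpha> dvd A $ 2 $ 1 \<Longrightarrow> p = \<alpha> \<and> s = 1" "int \<beta> dvd A $ 2 $ 1 \<Longrightarrow> p' = \<beta> \<and> s' = 1"
    "\<And>z. Im z > 0 \<Longrightarrow> slash 4 A f z =
       (of_nat p / of_nat s * eisenstein_E2 ((of_nat p * z + of_int t) / of_nat s) -
        of_nat p' / of_nat s' * eisenstein_E2 ((of_nat p' * z + of_int t') / of_nat s')) ^ 2"
proof -
  have det: "A $ 1 $ 1 * A $ 2 $ 2 - A $ 1 $ 2 * A $ 2 $ 1 = 1"
    using A by (simp add: SL2Z_def det_2)
  obtain p s t where P: "p > 0" "s > 0" "int \<alpha> dvd A $ 2 $ 1 \<Longrightarrow> p = \<alpha> \<and> s = 1"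
    "\<And>z. Im z > 0 \<Longrightarrow> of_nat \<alpha> * eisenstein_E2 (of_nat \<alpha> * moebius_act A z) =
       (of_int (A $ 2 $ 1) * z + of_int (A $ 2 $ 2)) ^ 2 * (of_nat p / of_nat s * eisenstein_E2 ((of_nat p * z + of_int t) / of_nat s))
         - 6 * \<i> / of_real pi * of_int (A $ 2 $ 1) * (of_int (A $ 2 $ 1) * z + of_int (A $ 2 $ 2))"
    using scaled_eisenstein_E2_transformation[OF det pos(1)] unfolding moebius_act_def by blast
  obtain p' s' t' where P': "p' > 0" "s' > 0" "int \<beta> dvd A $ 2 $ 1 \<Longrightarrow> p' = \<beta> \<and> s' = 1"
    "\<And>z. Im z > 0 \<Longrightarrow> of_nat \<beta> * eisenstein_E2 (of_nat \<beta> * moebius_act A z) =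
       (of_int (A $ 2 $ 1) * z + of_int (A $ 2 $ 2)) ^ 2 * (of_nat p' / of_nat s' * eisenstein_E2 ((of_nat p' * z + of_int t') / of_nat s'))
         - 6 * \<i> / of_real pi * of_int (A $ 2 $ 1) * (of_int (A $ 2 $ 1) * z + of_int (A $ 2 $ 2))"
    using scaled_eisenstein_E2_transformation[OF det pos(2)] unfolding moebius_act_def by blast
  show ?thesis
  proof (rule that[OF P(1,2) P'(1,2) P(3) P'(3)])
    fix z assume z: "Im z > 0"
    define j where "j = of_int (A $ 2 $ 1) * z + of_int (A $ 2 $ 2)"
    have j0: "j \<noteq> 0" unfolding j_def using denominator_nonzero[OF z det] .
    define X Y where "X = of_nat p / of_nat s * eisenstein_E2 ((of_nat p * z + of_int t) / of_nat s)"
      and "Y = of_nat p' / of_nat s' * eisenstein_E2 ((of_nat p' * z + of_int t') / of_nat s')"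
    have "f (moebius_act A z) = (j ^ 2 * X - j ^ 2 * Y) ^ 2"
      unfolding f_def P(4)[OF z] P'(4)[OF z] X_def Y_def j_def by simp
    also have "\<dots> = j ^ 4 * (X - Y) ^ 2"
      by (simp add: power_mult_distrib flip: right_diff_distrib)
    finally have "slash 4 A f z = j powi (- 4) * (j ^ 4 * (X - Y) ^ 2)"
      by (simp only: slash_def j_def)
    also have "\<dots> = (X - Y) ^ 2"
      using j0 by (simp add: power_int_minus)
    finally show "slash 4 A f z =
       (of_nat p / of_nat s * eisenstein_E2 ((of_nat p * z + of_int t) / of_nat s) -
        of_nat p' / of_nat s' * eisenstein_E2 ((of_nat p' * z + of_int t') / of_nat s')) ^ 2"
      unfolding X_def Y_def .
  qed (use P P' in auto)
qed

theorem lemma2p3: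
  fixes \<alpha> \<beta> :: nat
  assumes "\<alpha> > 0" and "\<beta> > 0"
  shows "(\<lambda>z. let q = exp (2 * of_real pi * \<i> * z) in
            (of_nat \<alpha> * eisenstein_L (q ^ \<alpha>) - of_nat \<beta> * eisenstein_L (q ^ \<beta>)) ^ 2)
         \<in> modular_forms 4 (Gamma0 (\<alpha> * \<beta>))"
proof -
  define f where "f = (\<lambda>z. (of_nat \<alpha> * eisenstein_E2 (of_nat \<alpha> * z) - of_nat \<beta> * eisenstein_E2 (of_nat \<beta> * z)) ^ 2)"
  have "exp (2 * of_real pi * \<i> * z) ^ n = exp (2 * of_real pi * \<i> * (of_nat n * z))" for n z
    by (simp add: exp_of_nat_mult[symmetric] mult_ac)
  then have f: "(\<lambda>z. let q = exp (2 * of_real pi * \<i> * z) in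
            (of_nat \<alpha> * eisenstein_L (q ^ \<alpha>) - of_nat \<beta> * eisenstein_L (q ^ \<beta>)) ^ 2) = f"
    by (simp add: fun_eq_iff f_def eisenstein_E2_def Let_def)
  have "f \<in> modular_forms 4 (Gamma0 (\<alpha> * \<beta>))"
    unfolding modular_forms_def mem_Collect_eq
  proof (intro conjI ballI)
    have "(eisenstein_E2 \<circ> (\<lambda>z. of_nat n * z)) holomorphic_on upper_half_plane" if "n > 0" for n :: nat
      by (rule holomorphic_on_compose_gen[OF _ eisenstein_E2_holomorphic])
         (use that in \<open>auto intro!: holomorphic_intros simp: upper_half_plane_def\<close>)
    then show "f holomorphic_on upper_half_plane"
      unfolding f_def using assms by (intro holomorphic_intros) (simp_all add: o_def)
  next
    fix A :: "int^2^2" and z assume A: "A \<in> Gamma0 (\<alpha> * \<beta>)" and z: "z \<in> upper_half_plane"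
    then have A': "A \<in> SL2Z" "int \<alpha> dvd A $ 2 $ 1" "int \<beta> dvd A $ 2 $ 1"
      by (auto simp: Gamma0_def dest: dvd_mult_left dvd_mult_right)
    obtain p s p' s' :: nat and t t' :: int where "p > 0" "s > 0" "p' > 0" "s' > 0"
      and scale: "int \<alpha> dvd A $ 2 $ 1 \<Longrightarrow> p = \<alpha> \<and> s = 1" "int \<beta> dvd A $ 2 $ 1 \<Longrightarrow> p' = \<beta> \<and> s' = 1"
      and slash: "\<And>z. Im z > 0 \<Longrightarrow> slash 4 A f z =
       (of_nat p / of_nat s * eisenstein_E2 ((of_nat p * z + of_int t) / of_nat s) -
        of_nat p' / of_nat s' * eisenstein_E2 ((of_nat p' * z + of_int t') / of_nat s')) ^ 2"
      by (rule slash_E2_difference[OF A'(1) assms, folded f_def]) (rule that; blast)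
    show "slash 4 A f z = f z"
      using slash[of z] scale A' z
      by (simp add: upper_half_plane_def f_def eisenstein_E2_plus_int)
  next
    fix A :: "int^2^2" assume A: "A \<in> SL2Z"
    obtain p s p' s' :: nat and t t' :: int where pos: "p > 0" "s > 0" "p' > 0" "s' > 0"
      and "int \<alpha> dvd A $ 2 $ 1 \<Longrightarrow> p = \<alpha> \<and> s = 1" "int \<beta> dvd A $ 2 $ 1 \<Longrightarrow> p' = \<beta> \<and> s' = 1"
      and slash: "\<And>z. Im z > 0 \<Longrightarrow> slash 4 A f z =
       (of_nat p / of_nat s * eisenstein_E2 ((of_nat p * z + of_int t) / of_nat s) -
        of_nat p' / of_nat s' * eisenstein_E2 ((of_nat p' * z + of_int t') / of_nat s')) ^ 2"
      by (rule slash_E2_difference[OF A assms, folded f_def]) (rule that; blast)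
    obtain \<phi> where \<phi>: "\<phi> holomorphic_on ball 0 1" "\<And>z. eisenstein_E2 ((of_nat p * z + of_int t) / of_nat s) =
       \<phi> (exp (2 * of_real pi * \<i> * z / of_nat (s * s')))"
      using eisenstein_E2_scaled_local_parameter[OF pos(1,2,4)] by blast
    obtain \<psi> where \<psi>: "\<psi> holomorphic_on ball 0 1" "\<And>z. eisenstein_E2 ((of_nat p' * z + of_int t') / of_nat s') =
       \<psi> (exp (2 * of_real pi * \<i> * z / of_nat (s' * s)))"
      using eisenstein_E2_scaled_local_parameter[OF pos(3,4,2)] by blast
    define g where "g u = (of_nat p / of_nat s * \<phi> u - of_nat p' / of_nat s' * \<psi> u) ^ 2" for u
    have "g holomorphic_on ball 0 1"
      unfolding g_def by (intro holomorphic_intros \<phi> \<psi>)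
    moreover have "slash 4 A f z = g (exp (2 * of_real pi * \<i> * z / of_nat (s * s')))" if "z \<in> upper_half_plane" for z
      using slash[of z] that unfolding upper_half_plane_def g_def \<phi>(2) \<psi>(2) mult.commute[of s' s] by blast
    moreover have "s * s' > 0" using pos by simp
    ultimately show "holomorphic_at_infinity (slash 4 A f)"
      unfolding holomorphic_at_infinity_def by blast
  qed
  then show ?thesis unfolding f .
qed

end
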